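(* Let $m \ge 2$ be an integer, and for each integer $n \ge 1$ let $p_n$ denote the $n$-th prime number. Then the set $$\left\{ \prod_{n \in P} \mathfrak{J}(D_{2^{m}p_{n}}) \;:\; P \subset \mathbb{N}\setminus\{0\},\ |P| < \infty \right\}$$ is dense in $(0,1]$.
   Context: For a finite group $G$, $\mathfrak{J}(G) = \mathrm{Nil}(G)/L(G)$, where $\mathrm{Nil}(G)$ is the number of nilpotent subgroups of $G$ (including the trivial subgroup, and $G$ itself if it is nilpotent) and $L(G)$ is the total number of subgroups of $G$. For a positive integer $k$, $D_{2k}$ denotes the dihedral group of order $2k$; thus $D_{2^m p_n}$ is the dihedral group of order $2^m p_n$. The empty product is $1$. *)

theory Defs
  imports
    "HOL-Analysis.Analysis"
    "HOL-Algebra.Generated_Groups"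
    "HOL-Computational_Algebra.Primes"
begin

text \<open>The lower central series starts at index 0 with the whole group.\<close>

primrec lower_central :: "('a, 'b) monoid_scheme \<Rightarrow> nat \<Rightarrow> 'a set" where
  "lower_central G 0 = carrier G"
| "lower_central G (Suc c) =
     generate G {x \<otimes>\<^bsub>G\<^esub> y \<otimes>\<^bsub>G\<^esub> inv\<^bsub>G\<^esub> x \<otimes>\<^bsub>G\<^esub> inv\<^bsub>G\<^esub> y | x y.
                   x \<in> lower_central G c \<and> y \<in> carrier G}"

definition nilpotent_group :: "('a, 'b) monoid_scheme \<Rightarrow> bool" where
  "nilpotent_group G \<longleftrightarrow> group G \<and> (\<exists>c. lower_central G c = {\<one>\<^bsub>G\<^esub>})"

definition num_subgroups :: "('a, 'b) monoid_scheme \<Rightarrow> nat" where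
  "num_subgroups G = card {H. subgroup H G}"

definition num_nilpotent_subgroups :: "('a, 'b) monoid_scheme \<Rightarrow> nat" where
  "num_nilpotent_subgroups G =
     card {H. subgroup H G \<and> nilpotent_group (G\<lparr>carrier := H\<rparr>)}"

definition nilpotency_ratio :: "('a, 'b) monoid_scheme \<Rightarrow> real" where
  "nilpotency_ratio G = real (num_nilpotent_subgroups G) / real (num_subgroups G)"

text \<open>
  The dihedral group of order \<open>2 * k\<close> for \<open>k > 0\<close>. The pair \<open>(i, e)\<close> stands for
  \<open>r^i s^e\<close>, where \<open>r^k = s^2 = 1\<close> and \<open>s r s = r^-1\<close>;
  the second component tells whether the reflection \<open>s\<close> occurs.
\<close>

definition dihedral_group :: "nat \<Rightarrow> (int \<times> bool) monoid" where
  "dihedral_group k =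
     \<lparr>carrier = {0..<int k} \<times> UNIV,
      monoid.mult = (\<lambda>(i, e) (j, f). ((if e then i - j else i + j) mod int k, e \<noteq> f)),
      one = (0, False)\<rparr>"

lemma group_dihedral_group:
  assumes "k > 0"
  shows "group (dihedral_group k)"
proof (rule groupI)
  fix x y assume "x \<in> carrier (dihedral_group k)" "y \<in> carrier (dihedral_group k)"
  then show "x \<otimes>\<^bsub>dihedral_group k\<^esub> y \<in> carrier (dihedral_group k)"
    using assms by (auto simp: dihedral_group_def split: prod.splits)
next
  show "\<one>\<^bsub>dihedral_group k\<^esub> \<in> carrier (dihedral_group k)"
    using assms by (simp add: dihedral_group_def)
next
  fix x y z
  show "x \<otimes>\<^bsub>dihedral_group k\<^esub> y \<otimes>\<^bsub>dihedral_group k\<^esub> z =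
        x \<otimes>\<^bsub>dihedral_group k\<^esub> (y \<otimes>\<^bsub>dihedral_group k\<^esub> z)"
    by (auto simp: dihedral_group_def mod_simps algebra_simps split: prod.splits)
next
  fix x assume "x \<in> carrier (dihedral_group k)"
  then show "\<one>\<^bsub>dihedral_group k\<^esub> \<otimes>\<^bsub>dihedral_group k\<^esub> x = x"
    by (auto simp: dihedral_group_def)
next
  fix x assume x: "x \<in> carrier (dihedral_group k)"
  obtain i e where ie: "x = (i, e)" by force
  let ?y = "if e then x else ((- i) mod int k, False)"
  have "?y \<in> carrier (dihedral_group k)"
    using x ie assms by (auto simp: dihedral_group_def)
  moreover have "?y \<otimes>\<^bsub>dihedral_group k\<^esub> x = \<one>\<^bsub>dihedral_group k\<^esub>"
    by (auto simp: dihedral_group_def ie mod_simps)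
  ultimately show "\<exists>y\<in>carrier (dihedral_group k).
      y \<otimes>\<^bsub>dihedral_group k\<^esub> x = \<one>\<^bsub>dihedral_group k\<^esub>" by blast
qed

lemma order_dihedral_group: "order (dihedral_group k) = 2 * k"
  by (simp add: order_def dihedral_group_def card_cartesian_product)

text \<open>One-based: \<open>nth_prime 1 = 2\<close>.\<close>

definition nth_prime :: "nat \<Rightarrow> nat" where
  "nth_prime n = enumerate {p. prime p} (n - 1)"

end

theory Submission
  imports Defs "HOL-Computational_Algebra.Squarefree"
begin

text \<open>
  The subgroups of the dihedral group of order \<open>2k\<close> are, for every \<open>d dvd k\<close>, one group of
  rotations and \<open>d\<close> groups containing reflections. The former are abelian, and the latter are
  dihedral of order \<open>2k/d\<close>, hence nilpotent iff \<open>k/d\<close> is a power of 2. For \<open>k = 2^M p\<close> with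
  \<open>p\<close> an odd prime, counting divisors shows that \<open>a\<close>, one minus the ratio, lies between \<open>1/(2p)\<close>
  and \<open>1/(p+1)\<close>. Since the reciprocals of the primes have infinite sum, the numbers \<open>a\<close> tend to 0
  but are not summable, so the finite products of the \<open>1 - a\<close> are dense in \<open>(0,1]\<close>.
\<close>

section \<open>Subgroups of dihedral groups\<close>

text \<open>For \<open>d dvd k\<close> this is the cyclic subgroup generated by r^d;
  \<open>d = k\<close> gives the trivial subgroup.\<close>

definition rotations :: "nat \<Rightarrow> nat \<Rightarrow> (int \<times> bool) set" where
  "rotations k d = {j \<in> {0..<int k}. int d dvd j} \<times> {False}"

text \<open>For \<open>d dvd k\<close>, adding these to \<open>rotations k d\<close> gives a
  dihedral subgroup of order 2k/d. Only the class of \<open>i\<close> modulo \<open>d\<close>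
  matters, so \<open>i\<close> need not be reduced.\<close>

definition reflections :: "nat \<Rightarrow> nat \<Rightarrow> int \<Rightarrow> (int \<times> bool) set" where
  "reflections k d i = {j \<in> {0..<int k}. int d dvd j - i} \<times> {True}"

lemma dihedral_group_simps [simp]:
  "carrier (dihedral_group k) = {0..<int k} \<times> UNIV"
  "(i, e) \<otimes>\<^bsub>dihedral_group k\<^esub> (j, f) = ((if e then i - j else i + j) mod int k, e \<noteq> f)"
  "\<one>\<^bsub>dihedral_group k\<^esub> = (0, False)"
  by (simp_all add: dihedral_group_def)

lemma inv_dihedral_group:
  assumes "0 \<le> i" "i < int k"
  shows "inv\<^bsub>dihedral_group k\<^esub> (i, e) = (if e then (i, True) else ((- i) mod int k, False))"
proof -
  from assms have "k > 0" by auto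
  then interpret group "dihedral_group k" by (rule group_dihedral_group)
  show ?thesis
    by (rule inv_equality) (use assms in \<open>auto simp: mod_simps\<close>)
qed

text \<open>Commutators kill the reflection part, and commuting r^a with a reflection doubles the
  exponent. This doubling governs the whole lower central series.\<close>

lemma commutator_dihedral_group:
  assumes "0 \<le> a" "a < int k" "0 \<le> b" "b < int k"
  shows "(a, e) \<otimes>\<^bsub>dihedral_group k\<^esub> (b, f) \<otimes>\<^bsub>dihedral_group k\<^esub> inv\<^bsub>dihedral_group k\<^esub> (a, e)
           \<otimes>\<^bsub>dihedral_group k\<^esub> inv\<^bsub>dihedral_group k\<^esub> (b, f) =
         ((if e then if f then 2 * (a - b) else - (2 * b) else if f then 2 * a else 0) mod int k, False)"
proof -
  have *: "(a + b + - a mod int k + - b mod int k) mod int k = 0" by (simp add: mod_simps)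
  show ?thesis using assms * by (auto simp: inv_dihedral_group mod_simps algebra_simps)
qed

lemma subgroup_rotations:
  assumes "k > 0" "d dvd k"
  shows "subgroup (rotations k d) (dihedral_group k)"
proof -
  interpret group "dihedral_group k" by (rule group_dihedral_group) fact
  show ?thesis
  proof (rule subgroupI)
    have "(0, False) \<in> rotations k d" using assms by (simp add: rotations_def)
    then show "rotations k d \<noteq> {}" by blast
  qed (use assms in \<open>auto simp: rotations_def inv_dihedral_group dvd_mod\<close>)
qed

text \<open>Membership of \<open>(a, e)\<close> amounts to one divisibility: \<open>d\<close>
  divides \<open>a - i\<close> for a reflection and \<open>a\<close> for a rotation. Multiplication
  adds or subtracts these quantities.\<close>

lemma subgroup_rotations_Un_reflections:
  assumes "k > 0" "d dvd k"
  shows "subgroup (rotations k d \<union> reflections k d i) (dihedral_group k)"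
proof -
  interpret group "dihedral_group k" by (rule group_dihedral_group) fact
  have d: "int d dvd int k" using assms by simp
  show ?thesis
  proof (rule subgroupI)
    have "(0, False) \<in> rotations k d" using assms by (simp add: rotations_def)
    then show "rotations k d \<union> reflections k d i \<noteq> {}" by blast
  next
    fix x y assume "x \<in> rotations k d \<union> reflections k d i" "y \<in> rotations k d \<union> reflections k d i"
    moreover obtain a e b f where "x = (a, e)" "y = (b, f)" by (metis surj_pair)
    ultimately have xy: "x = (a, e)" "y = (b, f)"
      "int d dvd (if e then a - i else a)" "int d dvd (if f then b - i else b)"
      by (auto simp: rotations_def reflections_def)
    \<comment> \<open>Reduction modulo \<open>k\<close> is invisible modulo \<open>d\<close>,
      because \<open>d dvd k\<close>.\<close>
    have *: "int d dvd z mod int k - w \<longleftrightarrow> int d dvd z - w" for z w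
    proof -
      have "(z mod int k - w) mod int d = (z - w) mod int d"
        using d by (metis mod_diff_left_eq mod_mod_cancel)
      then show ?thesis by (simp only: dvd_eq_mod_eq_0)
    qed
    let ?c = "if e then a - b else a + b"
    have "int d dvd (if e \<noteq> f then ?c - i else ?c)"
      using dvd_diff[OF xy(3,4)] dvd_add[OF xy(3,4)]
      by (cases e; cases f) (simp_all add: algebra_simps)
    then have "int d dvd (if e \<noteq> f then ?c mod int k - i else ?c mod int k)"
      by (cases "e = f") (simp_all only: * dvd_mod_iff[OF d] if_True if_False simp_thms not_True_eq_False)
    then show "x \<otimes>\<^bsub>dihedral_group k\<^esub> y \<in> rotations k d \<union> reflections k d i"
      using assms(1) unfolding xy dihedral_group_simps rotations_def reflections_def
      by (cases "e = f") simp_all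
  next
    fix x assume x: "x \<in> rotations k d \<union> reflections k d i"
    show "inv\<^bsub>dihedral_group k\<^esub> x \<in> rotations k d \<union> reflections k d i"
    proof (cases x)
      case (Pair a e)
      then show ?thesis
        using x assms(1) d
        by (cases e) (simp_all add: rotations_def reflections_def inv_dihedral_group dvd_mod_iff)
    qed
  qed (auto simp: rotations_def reflections_def)
qed

text \<open>Division with remainder by the least positive element, which exists because of
  \<open>k\<close>. Closure under differences already yields zero, negatives and sums.\<close>

lemma int_additive_subgroup_principal:
  fixes I :: "int set"
  assumes "k \<in> I" "k > 0" and diff: "\<And>x y. x \<in> I \<Longrightarrow> y \<in> I \<Longrightarrow> x - y \<in> I"
  obtains d :: nat where "d > 0" "I = {z. int d dvd z}"
proof -
  define d where "d = (LEAST d::nat. d > 0 \<and> int d \<in> I)"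
  have "nat k > 0 \<and> int (nat k) \<in> I" using assms by simp
  then have d: "d > 0 \<and> int d \<in> I" unfolding d_def by (rule LeastI)
  have least: "d \<le> e" if "e > 0" "int e \<in> I" for e
    unfolding d_def using that by (intro Least_le) auto
  have zero: "0 \<in> I" using diff[OF assms(1,1)] by simp
  have neg: "- x \<in> I" if "x \<in> I" for x using diff[OF zero that] by simp
  have add: "x + y \<in> I" if "x \<in> I" "y \<in> I" for x y using diff[OF that(1) neg[OF that(2)]] by simp
  have mult_nat: "int n * int d \<in> I" for n
    by (induction n) (use zero add d in \<open>auto simp: algebra_simps\<close>)
  have mult: "z * int d \<in> I" for z
    by (cases z rule: int_cases2) (use mult_nat neg[OF mult_nat] in auto)
  have "int d dvd z" if "z \<in> I" for z
  proof -
    have "z mod int d \<in> I"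
      using diff[OF that mult[of "z div int d"]] by (simp add: minus_div_mult_eq_mod)
    moreover have "0 \<le> z mod int d" "z mod int d < int d" using d by simp_all
    ultimately have "z mod int d = 0"
      using least[of "nat (z mod int d)"] by (cases "z mod int d = 0") auto
    then show ?thesis by (simp add: dvd_eq_mod_eq_0)
  qed
  then have "I = {z. int d dvd z}" using mult by (auto elim!: dvdE simp: mult.commute)
  with d that show ?thesis by blast
qed

text \<open>The exponents of the rotations in \<open>H\<close>, pulled back to the integers, form an
  additive subgroup containing \<open>k\<close>, so they are the multiples of some
  \<open>d dvd k\<close>. If \<open>H\<close> contains a reflection, its reflections form a single
  coset of its rotations.\<close>

lemma subgroup_dihedral_group_cases:
  assumes "k > 0" "subgroup H (dihedral_group k)"
  obtains d where "d dvd k" "H = rotations k d"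
  | d i where "d dvd k" "i < d" "H = rotations k d \<union> reflections k d (int i)"
proof -
  interpret group "dihedral_group k" by (rule group_dihedral_group) fact
  interpret subgroup H "dihedral_group k" by fact
  define I where "I = {z. (z mod int k, False) \<in> H}"
  have "int k \<in> I" using one_closed by (simp add: I_def)
  moreover have "x - y \<in> I" if "x \<in> I" "y \<in> I" for x y
  proof -
    have "inv\<^bsub>dihedral_group k\<^esub> (y mod int k, False) = ((- y) mod int k, False)"
      using assms by (simp add: inv_dihedral_group mod_simps)
    then have "((- y) mod int k, False) \<in> H"
      using m_inv_closed[of "(y mod int k, False)"] that by (simp add: I_def)
    then show ?thesis
      using m_closed[of "(x mod int k, False)" "((- y) mod int k, False)"] that
      by (simp add: I_def mod_simps)
  qed
  ultimately obtain d where d: "d > 0" "I = {z. int d dvd z}"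
    using int_additive_subgroup_principal[of "int k" I] assms by auto
  have dk: "d dvd k" using \<open>int k \<in> I\<close> d by simp
  have sub: "0 \<le> j \<and> j < int k" if "(j, e) \<in> H" for j e
    using subsetD[OF subset that] by simp
  have rot: "(j, False) \<in> H \<longleftrightarrow> (j, False) \<in> rotations k d" for j
  proof (cases "0 \<le> j \<and> j < int k")
    case True
    then have "(j, False) \<in> H \<longleftrightarrow> j \<in> I" by (simp add: I_def)
    then show ?thesis using True d by (simp add: rotations_def)
  qed (use sub in \<open>auto simp: rotations_def\<close>)
  show ?thesis
  proof (cases "\<exists>a. (a, True) \<in> H")
    case False
    then have "x \<in> H \<longleftrightarrow> x \<in> rotations k d" for x
      using rot by (cases x; cases "snd x") (auto simp: rotations_def)
    then show ?thesis using dk that(1) by blast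
  next
    case True
    then obtain a where a: "(a, True) \<in> H" by auto
    define i where "i = nat (a mod int d)"
    have i: "i < d" "int i = a mod int d" using d by (simp_all add: i_def nat_less_iff)
    have refl: "(j, True) \<in> H \<longleftrightarrow> (j, True) \<in> reflections k d (int i)" for j
    proof (cases "0 \<le> j \<and> j < int k")
      case True
      \<comment> \<open>Right multiplication by the fixed reflection \<open>(a, True)\<close>
        exchanges the rotations and the reflections of \<open>H\<close>.\<close>
      have "(j, True) \<in> H \<longleftrightarrow> j - a \<in> I"
      proof
        assume "(j, True) \<in> H"
        from m_closed[OF this a] show "j - a \<in> I" by (simp add: I_def)
      next
        assume "j - a \<in> I"
        then have "((j - a) mod int k, False) \<in> H" by (simp add: I_def)
        from m_closed[OF this a] show "(j, True) \<in> H" using True by (simp add: mod_simps)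
      qed
      also have "\<dots> \<longleftrightarrow> int d dvd j - int i"
        unfolding d i mem_Collect_eq by (metis dvd_eq_mod_eq_0 mod_diff_right_eq)
      finally show ?thesis using True by (simp add: reflections_def)
    qed (use sub in \<open>auto simp: reflections_def\<close>)
    have "x \<in> H \<longleftrightarrow> x \<in> rotations k d \<union> reflections k d (int i)" for x
    proof (cases x)
      case (Pair j e)
      then show ?thesis
        using rot[of j] refl[of j] by (cases e) (auto simp: rotations_def reflections_def)
    qed
    then show ?thesis using dk i(1) that(2) by blast
  qed
qed

lemma rotations_inject:
  assumes "k > 0" "d dvd k" "d' dvd k" "rotations k d = rotations k d'"
  shows "d = d'"
proof -
  have *: "e' dvd e" if "rotations k e = rotations k e'" "e dvd k" "e' dvd k" for e e'
  proof -
    \<comment> \<open>The generator r^e determines \<open>e\<close>; reducing modulo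
      \<open>k\<close> covers \<open>e = k\<close>, where it is the identity.\<close>
    have "(int e mod int k, False) \<in> rotations k e"
      using assms that(2) by (simp add: rotations_def dvd_mod)
    then have "(int e mod int k, False) \<in> rotations k e'" by (simp only: that(1))
    then have "int e' dvd int e mod int k" by (simp add: rotations_def)
    then show ?thesis using that by (simp add: dvd_mod_iff)
  qed
  show ?thesis
    using *[OF assms(4,2,3)] *[OF assms(4)[symmetric] assms(3,2)] by (rule dvd_antisym[rotated])
qed

lemma rotations_Un_reflections_inject:
  assumes "k > 0" "d dvd k" "d' dvd k" "i < d" "i' < d'"
    "rotations k d \<union> reflections k d (int i) = rotations k d' \<union> reflections k d' (int i')"
  shows "d = d' \<and> i = i'"
proof -
  have rot: "rotations k e = {x \<in> rotations k e \<union> reflections k e j. \<not> snd x}"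
    and refl: "reflections k e j = {x \<in> rotations k e \<union> reflections k e j. snd x}" for e j
    by (auto simp: rotations_def reflections_def)
  have "rotations k d = rotations k d'"
    using rot[of d "int i"] rot[of d' "int i'"] assms(6) by simp
  with assms(1-3) have d: "d = d'" by (rule rotations_inject)
  have eq: "reflections k d (int i) = reflections k d' (int i')"
    using refl[of d "int i"] refl[of d' "int i'"] assms(6) by simp
  have "i < k" using assms(4) dvd_imp_le[OF assms(2,1)] by simp
  then have "(int i, True) \<in> reflections k d (int i)" by (simp add: reflections_def)
  then have "(int i, True) \<in> reflections k d' (int i')" by (simp only: eq)
  then have "int d dvd int i - int i'" using d by (simp add: reflections_def)
  then have "int i mod int d = int i' mod int d" by (simp add: mod_eq_dvd_iff)
  then show ?thesis using d assms by simp
qed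

section \<open>Nilpotent subgroups of dihedral groups\<close>

lemma (in group) lower_central_subset_carrier: "lower_central G c \<subseteq> carrier G"
proof (induction c)
  case (Suc c)
  show ?case
    unfolding lower_central.simps
  proof (rule generate_incl, clarify)
    fix x y assume "x \<in> lower_central G c" "y \<in> carrier G"
    with Suc have "x \<in> carrier G" "y \<in> carrier G" by auto
    then show "x \<otimes> y \<otimes> inv x \<otimes> inv y \<in> carrier G" by simp
  qed
qed simp

text \<open>Moves inverses and generated subgroups from the restricted group to the ambient one,
  where explicit formulas for commutators apply.\<close>

lemma (in group) lower_central_subgroup_Suc:
  assumes "subgroup H G"
  shows "lower_central (G\<lparr>carrier := H\<rparr>) (Suc c) =
    generate G {x \<otimes> y \<otimes> inv x \<otimes> inv y | x y. x \<in> lower_central (G\<lparr>carrier := H\<rparr>) c \<and> y \<in> H}"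
    (is "_ = generate G ?C")
proof -
  interpret subgroup H G by fact
  have sub: "lower_central (G\<lparr>carrier := H\<rparr>) c \<subseteq> H"
    using group.lower_central_subset_carrier[OF subgroup_imp_group[OF assms]] by simp
  then have "?C \<subseteq> H" by blast
  have "lower_central (G\<lparr>carrier := H\<rparr>) (Suc c) = generate (G\<lparr>carrier := H\<rparr>) ?C"
  proof -
    have "x \<otimes> y \<otimes> inv\<^bsub>G\<lparr>carrier := H\<rparr>\<^esub> x \<otimes> inv\<^bsub>G\<lparr>carrier := H\<rparr>\<^esub> y = x \<otimes> y \<otimes> inv x \<otimes> inv y"
      if "x \<in> lower_central (G\<lparr>carrier := H\<rparr>) c" "y \<in> H" for x y
      using that sub assms by (auto simp: m_inv_consistent)
    then have "{x \<otimes> y \<otimes> inv\<^bsub>G\<lparr>carrier := H\<rparr>\<^esub> x \<otimes> inv\<^bsub>G\<lparr>carrier := H\<rparr>\<^esub> y | x y.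
        x \<in> lower_central (G\<lparr>carrier := H\<rparr>) c \<and> y \<in> H} = ?C"
      by (smt (verit) Collect_cong)
    then show ?thesis by simp
  qed
  also have "\<dots> = generate G ?C"
    using \<open>?C \<subseteq> H\<close> assms by (rule generate_consistent)
  finally show ?thesis .
qed

lemma (in group) lower_central_Suc_subgroup_subset:
  assumes "subgroup H G" "subgroup K G"
    and "\<And>x y. x \<in> lower_central (G\<lparr>carrier := H\<rparr>) c \<Longrightarrow> y \<in> H \<Longrightarrow> x \<otimes> y \<otimes> inv x \<otimes> inv y \<in> K"
  shows "lower_central (G\<lparr>carrier := H\<rparr>) (Suc c) \<subseteq> K"
  unfolding lower_central_subgroup_Suc[OF assms(1)]
  using assms(3) by (intro generate_subgroup_incl[OF _ assms(2)]) blast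

text \<open>Lower bound for the series: start from r^d and commute repeatedly with a reflection of
  \<open>H\<close>, doubling the exponent each time.\<close>

lemma double_power_rotation_in_lower_central:
  assumes "k > 0" "d dvd k" and H: "H = rotations k d \<union> reflections k d i"
  shows "((int d * 2 ^ c) mod int k, False) \<in> lower_central (dihedral_group k\<lparr>carrier := H\<rparr>) c"
proof (induction c)
  case 0
  then show ?case using assms by (simp add: rotations_def dvd_mod)
next
  case (Suc c)
  interpret group "dihedral_group k" by (rule group_dihedral_group) fact
  have sub: "subgroup H (dihedral_group k)"
    using assms subgroup_rotations_Un_reflections by blast
  \<comment> \<open>As \<open>i\<close> may lie outside the range of exponents, the reflection used
    is the one at \<open>i mod int k\<close>, still congruent to \<open>i\<close> modulo
    \<open>d\<close>.\<close>
  have "int d dvd i mod int k - i"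
    using assms(2) by (metis dvd_trans int_dvd_int_iff mod_eq_dvd_iff mod_mod_trivial)
  then have s: "(i mod int k, True) \<in> H"
    using assms by (simp add: reflections_def)
  let ?r = "((int d * 2 ^ c) mod int k, False)" and ?s = "(i mod int k, True)"
  have "((int d * 2 ^ Suc c) mod int k, False) =
      ?r \<otimes>\<^bsub>dihedral_group k\<^esub> ?s \<otimes>\<^bsub>dihedral_group k\<^esub> inv\<^bsub>dihedral_group k\<^esub> ?r
        \<otimes>\<^bsub>dihedral_group k\<^esub> inv\<^bsub>dihedral_group k\<^esub> ?s"
    using assms(1) by (subst commutator_dihedral_group) (auto simp: mod_simps algebra_simps)
  with Suc s show ?case
    unfolding lower_central_subgroup_Suc[OF sub] by (blast intro: generate.incl)
qed

text \<open>Matching upper bound: each commutator doubles a multiple of the previous step. Exponents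
  are known only modulo \<open>k\<close>, hence the gcd, which also makes the bound a subgroup. It
  starts at \<open>Suc c\<close> since term 0 is \<open>H\<close> itself, reflections
  included.\<close>

lemma lower_central_subset_rotations:
  assumes "k > 0" "d dvd k" and H: "H = rotations k d \<union> reflections k d i"
  shows "lower_central (dihedral_group k\<lparr>carrier := H\<rparr>) (Suc c) \<subseteq> rotations k (gcd (d * 2 ^ Suc c) k)"
proof -
  interpret group "dihedral_group k" by (rule group_dihedral_group) fact
  have sub: "subgroup H (dihedral_group k)"
    using assms subgroup_rotations_Un_reflections by blast
  have H_cases: "0 \<le> a \<and> a < int k \<and> int d dvd (if e then a - i else a)" if "(a, e) \<in> H" for a e
    using that by (cases e) (auto simp: H rotations_def reflections_def)
  have twice: "int (gcd (d * 2 ^ Suc c) k) dvd (2 * z) mod int k" if "int (d * 2 ^ c) dvd z" for z c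
  proof -
    have "int (d * 2 ^ Suc c) dvd 2 * z"
      using mult_dvd_mono[OF dvd_refl[of 2] that] by (simp add: mult_ac)
    then have "int (gcd (d * 2 ^ Suc c) k) dvd 2 * z"
      by (meson dvd_trans gcd_dvd1 int_dvd_int_iff)
    then show ?thesis by (simp add: dvd_mod del: power_Suc)
  qed
  show ?thesis
  proof (induction c)
    case 0
    show ?case
    proof (rule lower_central_Suc_subgroup_subset[OF sub subgroup_rotations])
      fix x y
      assume "x \<in> lower_central (dihedral_group k\<lparr>carrier := H\<rparr>) 0" "y \<in> H"
      moreover obtain a e b f where xy: "x = (a, e)" "y = (b, f)" by (metis surj_pair)
      ultimately have a: "(a, e) \<in> H" and b: "(b, f) \<in> H" by simp_all
      \<comment> \<open>Both reflections have exponents congruent to \<open>i\<close>, so the shift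
        cancels.\<close>
      have "int (d * 2 ^ 0) dvd a - b" if e f
        using H_cases[OF a] H_cases[OF b] that dvd_diff[of "int d" "a - i" "b - i"] by simp
      then show "x \<otimes>\<^bsub>dihedral_group k\<^esub> y \<otimes>\<^bsub>dihedral_group k\<^esub> inv\<^bsub>dihedral_group k\<^esub> x
          \<otimes>\<^bsub>dihedral_group k\<^esub> inv\<^bsub>dihedral_group k\<^esub> y \<in> rotations k (gcd (d * 2 ^ Suc 0) k)"
        using H_cases[OF a] H_cases[OF b] twice[of 0 "a - b"] twice[of 0 "- b"] twice[of 0 a] \<open>k > 0\<close>
        unfolding xy by (subst commutator_dihedral_group) (auto simp: rotations_def)
    qed (use assms in auto)
  next
    case (Suc c)
    show ?case
    proof (rule lower_central_Suc_subgroup_subset[OF sub subgroup_rotations])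
      fix x y
      assume "x \<in> lower_central (dihedral_group k\<lparr>carrier := H\<rparr>) (Suc c)" "y \<in> H"
      moreover obtain a e b f where xy: "x = (a, e)" "y = (b, f)" by (metis surj_pair)
      ultimately have "(a, e) \<in> rotations k (gcd (d * 2 ^ Suc c) k)" and b: "(b, f) \<in> H"
        using Suc by blast+
      then have a: "0 \<le> a" "a < int k" "\<not> e" "int (gcd (d * 2 ^ Suc c) k) dvd a"
        by (auto simp: rotations_def simp del: power_Suc)
      \<comment> \<open>With u = \<open>d * 2 ^ Suc c\<close>: gcd(2u, k) divides gcd(2u, 2k) = 2
        gcd(u, k), so the doubled exponent satisfies the next bound.\<close>
      have "gcd (d * 2 ^ Suc (Suc c)) k dvd gcd (2 * (d * 2 ^ Suc c)) (2 * k)"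
        by (simp add: mult_ac)
      then have "int (gcd (d * 2 ^ Suc (Suc c)) k) dvd int (2 * gcd (d * 2 ^ Suc c) k)"
        by (simp only: gcd_mult_distrib_nat int_dvd_int_iff)
      also have "\<dots> dvd 2 * a" using a(4) by (simp del: power_Suc)
      finally have "int (gcd (d * 2 ^ Suc (Suc c)) k) dvd 2 * a" .
      then have "int (gcd (d * 2 ^ Suc (Suc c)) k) dvd (2 * a) mod int k"
        by (simp add: dvd_mod del: power_Suc)
      then show "x \<otimes>\<^bsub>dihedral_group k\<^esub> y \<otimes>\<^bsub>dihedral_group k\<^esub> inv\<^bsub>dihedral_group k\<^esub> x
          \<otimes>\<^bsub>dihedral_group k\<^esub> inv\<^bsub>dihedral_group k\<^esub> y \<in> rotations k (gcd (d * 2 ^ Suc (Suc c)) k)"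
        using a H_cases[OF b] \<open>k > 0\<close>
        unfolding xy by (subst commutator_dihedral_group) (auto simp: rotations_def simp del: power_Suc)
    qed (use assms in auto)
  qed
qed

lemma nilpotent_group_rotations:
  assumes "k > 0" "d dvd k"
  shows "nilpotent_group (dihedral_group k\<lparr>carrier := rotations k d\<rparr>)"
proof -
  interpret group "dihedral_group k" by (rule group_dihedral_group) fact
  have sub: "subgroup (rotations k d) (dihedral_group k)"
    using assms by (rule subgroup_rotations)
  have "lower_central (dihedral_group k\<lparr>carrier := rotations k d\<rparr>) (Suc 0) \<subseteq> {\<one>\<^bsub>dihedral_group k\<^esub>}"
  proof (rule lower_central_Suc_subgroup_subset[OF sub triv_subgroup])
    fix x y
    assume "x \<in> lower_central (dihedral_group k\<lparr>carrier := rotations k d\<rparr>) 0" "y \<in> rotations k d"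
    moreover obtain a e b f where xy: "x = (a, e)" "y = (b, f)" by (metis surj_pair)
    ultimately show "x \<otimes>\<^bsub>dihedral_group k\<^esub> y \<otimes>\<^bsub>dihedral_group k\<^esub> inv\<^bsub>dihedral_group k\<^esub> x
          \<otimes>\<^bsub>dihedral_group k\<^esub> inv\<^bsub>dihedral_group k\<^esub> y \<in> {\<one>\<^bsub>dihedral_group k\<^esub>}"
      unfolding xy by (subst commutator_dihedral_group) (auto simp: rotations_def)
  qed
  moreover have "\<one>\<^bsub>dihedral_group k\<^esub> \<in> lower_central (dihedral_group k\<lparr>carrier := rotations k d\<rparr>) (Suc 0)"
    unfolding lower_central_subgroup_Suc[OF sub] by (rule generate.one)
  ultimately show ?thesis
    unfolding nilpotent_group_def using subgroup_imp_group[OF sub]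
    by (auto intro!: exI[of _ "Suc 0"] simp del: lower_central.simps)
qed

text \<open>The two bounds on the lower central series decide when it reaches the trivial group.
  Given \<open>d dvd k\<close>, the condition expresses without division that k/d is a power of
  2.\<close>

lemma nilpotent_group_rotations_Un_reflections_iff:
  assumes "k > 0" "d dvd k"
  shows "nilpotent_group (dihedral_group k\<lparr>carrier := rotations k d \<union> reflections k d i\<rparr>) \<longleftrightarrow>
    (\<exists>c. k dvd d * 2 ^ c)" (is "nilpotent_group ?G \<longleftrightarrow> _")
proof
  assume "nilpotent_group ?G"
  then obtain c where "lower_central ?G c = {\<one>\<^bsub>?G\<^esub>}" by (auto simp: nilpotent_group_def)
  with double_power_rotation_in_lower_central[OF assms refl, of c i]
  have "int (d * 2 ^ c) mod int k = 0" by simp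
  then show "\<exists>c. k dvd d * 2 ^ c" by (metis dvd_eq_mod_eq_0 int_dvd_int_iff)
next
  assume "\<exists>c. k dvd d * 2 ^ c"
  then obtain c where c: "k dvd d * 2 ^ c" by blast
  interpret group "dihedral_group k" by (rule group_dihedral_group) fact
  have sub: "subgroup (rotations k d \<union> reflections k d i) (dihedral_group k)"
    using assms by (rule subgroup_rotations_Un_reflections)
  \<comment> \<open>The exponent is raised by one because the upper bound on the series is available
    only from index 1 on.\<close>
  have "k dvd d * 2 ^ Suc c" using dvd_mult[OF c, of 2] by (simp add: mult_ac)
  then have "gcd (d * 2 ^ Suc c) k = k" by (metis gcd_nat.absorb2)
  then have "lower_central ?G (Suc c) \<subseteq> rotations k k"
    using lower_central_subset_rotations[OF assms refl, of i c] by metis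
  also have "\<dots> \<subseteq> {\<one>\<^bsub>?G\<^esub>}" by (auto simp: rotations_def dest: zdvd_imp_le)
  finally have "lower_central ?G (Suc c) \<subseteq> {\<one>\<^bsub>?G\<^esub>}" .
  moreover have "\<one>\<^bsub>?G\<^esub> \<in> lower_central ?G (Suc c)"
    unfolding lower_central_subgroup_Suc[OF sub] using generate.one[of "dihedral_group k"] by simp
  ultimately show "nilpotent_group ?G"
    unfolding nilpotent_group_def using subgroup_imp_group[OF sub]
    by (auto intro!: exI[of _ "Suc c"] simp del: lower_central.simps)
qed

section \<open>Counting subgroups and nilpotent subgroups\<close>

text \<open>The parameter \<open>E\<close> lets one count serve twice: with all divisors of
  \<open>k\<close> for all subgroups, and with those where k/d is a power of 2 for the nilpotent
  ones. Each \<open>d\<close> in \<open>E\<close> contributes \<open>d\<close> subgroups with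
  reflections, one for each residue.\<close>

lemma card_rotations_reflections:
  assumes "k > 0" "E \<subseteq> {d. d dvd k}"
  shows "card (rotations k ` {d. d dvd k} \<union>
           (\<lambda>(d, i). rotations k d \<union> reflections k d (int i)) ` (SIGMA d:E. {..<d})) =
         card {d. d dvd k} + \<Sum>E"
proof -
  have fin: "finite {d. d dvd k}" using assms by simp
  with assms(2) have finE: "finite E" by (rule finite_subset)
  have ne: "rotations k e \<noteq> rotations k d \<union> reflections k d (int i)" if "d dvd k" "i < d" for e d i
  proof -
    have "(int i, True) \<in> reflections k d (int i)"
      using dvd_imp_le[OF that(1) assms(1)] that(2) by (simp add: reflections_def)
    moreover have "(int i, True) \<notin> rotations k e" by (simp add: rotations_def)
    ultimately show ?thesis by blast
  qed
  have "rotations k ` {d. d dvd k} \<inter>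
      (\<lambda>(d, i). rotations k d \<union> reflections k d (int i)) ` (SIGMA d:E. {..<d}) = {}"
  proof (rule Int_emptyI)
    fix H
    assume "H \<in> rotations k ` {d. d dvd k}"
      and "H \<in> (\<lambda>(d, i). rotations k d \<union> reflections k d (int i)) ` (SIGMA d:E. {..<d})"
    then obtain e d i where "H = rotations k e" "d \<in> E" "i < d"
      "H = rotations k d \<union> reflections k d (int i)" by (elim imageE SigmaE) simp
    with ne[of d i e] assms(2) show False by blast
  qed
  moreover have "inj_on (rotations k) {d. d dvd k}"
    using rotations_inject[OF assms(1)] by (auto intro: inj_onI)
  moreover have "inj_on (\<lambda>(d, i). rotations k d \<union> reflections k d (int i)) (SIGMA d:E. {..<d})"
  proof (rule inj_onI, clarsimp)
    fix d i d' i'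
    assume "d \<in> E" "d' \<in> E" "i < d" "i' < d'"
      "rotations k d \<union> reflections k d (int i) = rotations k d' \<union> reflections k d' (int i')"
    then show "d = d' \<and> i = i'"
      using rotations_Un_reflections_inject[OF assms(1), of d d' i i'] assms(2) by blast
  qed
  ultimately show ?thesis
    using fin finE by (simp add: card_Un_disjoint card_image)
qed

lemma num_subgroups_dihedral_group:
  assumes "k > 0"
  shows "num_subgroups (dihedral_group k) = card {d. d dvd k} + \<Sum>{d. d dvd k}"
proof -
  have "{H. subgroup H (dihedral_group k)} = rotations k ` {d. d dvd k} \<union>
      (\<lambda>(d, i). rotations k d \<union> reflections k d (int i)) ` (SIGMA d:{d. d dvd k}. {..<d})" (is "?L = ?R")
  proof (rule Set.set_eqI)
    fix H
    show "H \<in> ?L \<longleftrightarrow> H \<in> ?R"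
    proof
      assume "H \<in> ?L"
      then have "subgroup H (dihedral_group k)" by simp
      with assms show "H \<in> ?R"
      proof (cases rule: subgroup_dihedral_group_cases)
        case (2 d i)
        then have "(d, i) \<in> (SIGMA d:{d. d dvd k}. {..<d})" by simp
        then show ?thesis using 2(3) by (intro UnI2) (auto intro!: image_eqI)
      qed auto
    next
      assume "H \<in> ?R"
      then show "H \<in> ?L"
        using assms by (auto simp: subgroup_rotations subgroup_rotations_Un_reflections)
    qed
  qed
  then show ?thesis
    unfolding num_subgroups_def using card_rotations_reflections[OF assms order_refl] by simp
qed

lemma num_nilpotent_subgroups_dihedral_group:
  assumes "k > 0"
  shows "num_nilpotent_subgroups (dihedral_group k) =
    card {d. d dvd k} + \<Sum>{d. d dvd k \<and> (\<exists>c. k dvd d * 2 ^ c)}"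
proof -
  have "{H. subgroup H (dihedral_group k) \<and> nilpotent_group (dihedral_group k\<lparr>carrier := H\<rparr>)} =
      rotations k ` {d. d dvd k} \<union>
      (\<lambda>(d, i). rotations k d \<union> reflections k d (int i)) `
        (SIGMA d:{d. d dvd k \<and> (\<exists>c. k dvd d * 2 ^ c)}. {..<d})" (is "?L = ?R")
  proof (rule Set.set_eqI)
    fix H
    show "H \<in> ?L \<longleftrightarrow> H \<in> ?R"
    proof
      assume "H \<in> ?L"
      then have H: "subgroup H (dihedral_group k)" "nilpotent_group (dihedral_group k\<lparr>carrier := H\<rparr>)"
        by auto
      from assms H(1) show "H \<in> ?R"
      proof (cases rule: subgroup_dihedral_group_cases)
        case (2 d i)
        then have "\<exists>c. k dvd d * 2 ^ c"
          using H(2) nilpotent_group_rotations_Un_reflections_iff[OF assms 2(1)] by simp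
        then have "(d, i) \<in> (SIGMA d:{d. d dvd k \<and> (\<exists>c. k dvd d * 2 ^ c)}. {..<d})"
          using 2 by simp
        then show ?thesis using 2(3) by (intro UnI2) (auto intro!: image_eqI)
      qed auto
    next
      assume "H \<in> ?R"
      then show "H \<in> ?L"
        using assms
        by (auto simp: subgroup_rotations nilpotent_group_rotations subgroup_rotations_Un_reflections
            nilpotent_group_rotations_Un_reflections_iff)
    qed
  qed
  then show ?thesis
    unfolding num_nilpotent_subgroups_def by (simp only:) (rule card_rotations_reflections, use assms in auto)
qed

section \<open>The ratio for k = 2^M p\<close>

text \<open>Needed for the prime 2, where k is a power of 2 and every subgroup is nilpotent.\<close>

lemma nilpotency_ratio_dihedral_group_power_2:
  "nilpotency_ratio (dihedral_group (2 ^ M)) = 1"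
proof -
  have "{d. d dvd 2 ^ M \<and> (\<exists>c. 2 ^ M dvd d * 2 ^ c)} = {d::nat. d dvd 2 ^ M}"
    using dvd_triv_right by blast
  then have "num_nilpotent_subgroups (dihedral_group (2 ^ M)) = num_subgroups (dihedral_group (2 ^ M))"
    by (simp add: num_subgroups_dihedral_group num_nilpotent_subgroups_dihedral_group)
  moreover have "card {d::nat. d dvd 2 ^ M} > 0" by (auto simp: card_gt_0_iff)
  then have "num_subgroups (dihedral_group (2 ^ M)) > 0"
    by (simp add: num_subgroups_dihedral_group)
  ultimately show ?thesis by (simp add: nilpotency_ratio_def)
qed

text \<open>The divisors are 2^i and 2^i p with i at most \<open>M\<close>, and k/d is a power of 2
  exactly for the second kind. So the non-nilpotent subgroups number the sum of the 2^i, which is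
  the numerator on the right.\<close>

lemma nilpotency_ratio_dihedral_group_odd_prime:
  fixes p :: nat
  assumes "prime p" "odd p"
  shows "nilpotency_ratio (dihedral_group (2 ^ M * p)) =
    1 - (2 ^ Suc M - 1) / (2 * real (Suc M) + (2 ^ Suc M - 1) * (real p + 1))"
proof -
  define A where "A = (\<lambda>i. 2 ^ i :: nat) ` {..M}"
  define B where "B = (\<lambda>i. 2 ^ i * p) ` {..M}"
  have p: "p > 0" using assms(1) prime_gt_0_nat by blast
  have two: "prime (2::nat)" by simp
  have D: "{d. d dvd 2 ^ M * p} = A \<union> B"
  proof (intro equalityI subsetI)
    fix d assume "d \<in> {d. d dvd 2 ^ M * p}"
    then obtain a b where ab: "d = a * b" "a dvd 2 ^ M" "b dvd p"
      using division_decomp[of d "2 ^ M" p] by auto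
    then obtain i where "i \<le> M" "a = 2 ^ i" using divides_primepow_nat[OF two] by blast
    moreover have "b = 1 \<or> b = p" using ab(3) assms(1) by (simp add: prime_nat_iff)
    ultimately show "d \<in> A \<union> B" using ab(1) by (auto simp: A_def B_def)
  qed (auto simp: A_def B_def le_imp_power_dvd intro: mult_dvd_mono dvd_mult2)
  have A: "\<not> 2 ^ M * p dvd d * 2 ^ c" if "d \<in> A" for d c
  proof
    assume "2 ^ M * p dvd d * 2 ^ c"
    with that have "\<exists>i. p dvd 2 ^ (i + c)"
      by (auto simp: A_def power_add dest: dvd_mult_right)
    then have "p dvd 2" using assms(1) prime_dvd_power by blast
    then have "p = 2" using assms(1) two by (metis primes_dvd_imp_eq)
    with assms(2) show False by simp
  qed
  have B: "2 ^ M * p dvd d * 2 ^ M" if "d \<in> B" for d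
    using that by (auto simp: B_def)
  have disj: "A \<inter> B = {}" using A B by blast
  have E: "{d. d dvd 2 ^ M * p \<and> (\<exists>c. 2 ^ M * p dvd d * 2 ^ c)} = B"
    using A B D by blast
  have inj: "inj_on (\<lambda>i. 2 ^ i :: nat) {..M}" "inj_on (\<lambda>i. 2 ^ i * p) {..M}"
    using p by (auto simp: inj_on_def)
  have fin: "finite A" "finite B" by (simp_all add: A_def B_def)
  have card: "card (A \<union> B) = 2 * Suc M"
    using fin disj inj by (simp add: card_Un_disjoint card_image A_def B_def)
  have geom: "(\<Sum>i\<le>M. 2 ^ i :: real) = 2 ^ Suc M - 1"
    by (induction M) auto
  have sumA: "real (\<Sum>A) = 2 ^ Suc M - 1"
    unfolding A_def by (subst sum.reindex[OF inj(1)]) (simp add: geom del: power_Suc)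
  have sumB: "real (\<Sum>B) = (2 ^ Suc M - 1) * real p"
    unfolding B_def by (subst sum.reindex[OF inj(2)])
      (simp add: geom del: power_Suc flip: sum_distrib_right)
  have sumAB: "real (\<Sum>(A \<union> B)) = (2 ^ Suc M - 1) * (real p + 1)"
    using fin disj sumA sumB by (simp add: sum.union_disjoint distrib_left del: power_Suc)
  have k: "2 ^ M * p > 0" using p by simp
  have "real (num_subgroups (dihedral_group (2 ^ M * p))) =
      2 * real (Suc M) + (2 ^ Suc M - 1) * (real p + 1)"
    unfolding num_subgroups_dihedral_group[OF k] D card of_nat_add sumAB by simp
  moreover have "real (num_nilpotent_subgroups (dihedral_group (2 ^ M * p))) =
      2 * real (Suc M) + (2 ^ Suc M - 1) * real p"
    unfolding num_nilpotent_subgroups_dihedral_group[OF k] E unfolding D card of_nat_add sumB by simp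
  moreover have "2 * real (Suc M) + (2 ^ Suc M - 1) * (real p + 1) > 0"
    by (intro add_pos_nonneg mult_nonneg_nonneg) (simp_all del: power_Suc)
  ultimately show ?thesis
    unfolding nilpotency_ratio_def by (simp add: divide_simps del: power_Suc) (simp add: algebra_simps)
qed

text \<open>With A = 2^(M+1) - 1, the upper bound drops 2(M+1) from the denominator. For the lower
  one, M+1 \<le> A and p \<ge> 3 bound the denominator by A(p+3) \<le> 2Ap. For p = 2 the value is
  0, so oddness is required there.\<close>

lemma nilpotency_ratio_dihedral_group_prime_bounds:
  fixes p M :: nat
  assumes "prime p"
  defines "a \<equiv> 1 - nilpotency_ratio (dihedral_group (2 ^ M * p))"
  shows "0 \<le> a" "a \<le> 1 / (real p + 1)" and "odd p \<Longrightarrow> 1 / (2 * real p) \<le> a"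
proof -
  define A :: real where "A = 2 ^ Suc M - 1"
  have "Suc M < 2 ^ Suc M" by (rule less_exp)
  then have "Suc (Suc M) \<le> 2 ^ Suc M" by (simp only: Suc_le_eq)
  then have "real (Suc (Suc M)) \<le> real (2 ^ Suc M)" by (simp only: of_nat_le_iff)
  then have A: "real (Suc M) \<le> A" "A > 0" by (simp_all add: A_def)
  have eq: "a = A / (2 * real (Suc M) + A * (real p + 1))" if "odd p"
    unfolding a_def A_def using nilpotency_ratio_dihedral_group_odd_prime[OF assms(1) that] by simp
  have zero: "a = 0" if "even p"
  proof -
    have "p = 2" using assms(1) that by (metis primes_dvd_imp_eq two_is_prime_nat)
    then show ?thesis
      using nilpotency_ratio_dihedral_group_power_2[of "Suc M"] by (simp add: a_def mult.commute)
  qed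
  show "0 \<le> a" using eq zero A by (cases "even p") auto
  show "a \<le> 1 / (real p + 1)"
  proof (cases "even p")
    case False
    have "a \<le> A / (A * (real p + 1))"
      unfolding eq[OF False] using A prime_gt_0_nat[OF assms(1)]
      by (intro divide_left_mono mult_pos_pos add_pos_pos) auto
    then show ?thesis using A by simp
  qed (simp add: zero)
  show "1 / (2 * real p) \<le> a" if "odd p"
  proof -
    have "p \<noteq> 2" using that by auto
    then have "p \<ge> 3" using prime_ge_2_nat[OF assms(1)] by simp
    then have "3 * A \<le> A * real p" using A by simp
    have "2 * real (Suc M) + A * (real p + 1) = 2 * real (Suc M) + A + A * real p"
      by (simp add: distrib_left)
    also have "\<dots> \<le> 3 * A + A * real p" using A by simp
    also have "\<dots> \<le> A * (2 * real p)" using \<open>3 * A \<le> A * real p\<close> by simp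
    finally have "2 * real (Suc M) + A * (real p + 1) \<le> A * (2 * real p)" .
    then have "A / (A * (2 * real p)) \<le> a"
      unfolding eq[OF that] using A \<open>p \<ge> 3\<close> by (intro divide_left_mono mult_pos_pos add_pos_pos) auto
    then show ?thesis using A by simp
  qed
qed

section \<open>Divergence of the sum of the reciprocals of the primes\<close>

lemma squarefree_eq_prod_prime_factors:
  fixes n :: nat
  assumes "squarefree n"
  shows "n = \<Prod>(prime_factors n)"
proof -
  from assms have "n \<noteq> 0" by (metis not_squarefree_0)
  then have "n = (\<Prod>p\<in>prime_factors n. p ^ multiplicity p n)"
    by (simp add: prime_factorization_nat)
  also have "\<dots> = (\<Prod>p\<in>prime_factors n. p)"
  proof (rule prod.cong[OF refl])
    fix p assume p: "p \<in> prime_factors n"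
    then have "multiplicity p n \<le> 1"
      using assms \<open>n \<noteq> 0\<close> by (auto simp: squarefree_factorial_semiring'')
    moreover have "multiplicity p n > 0"
      using p by (simp add: prime_factors_multiplicity)
    ultimately show "p ^ multiplicity p n = p" by (simp add: le_eq_less_or_eq)
  qed
  finally show ?thesis by simp
qed

text \<open>A number is determined by the set of prime factors of its squarefree part and by its
  square part.\<close>

lemma card_smooth_le:
  fixes x :: nat
  assumes "finite A"
  shows "card {n \<in> {1..x\<^sup>2}. prime_factors n \<subseteq> A} \<le> 2 ^ card A * x"
proof -
  let ?B = "{n \<in> {1..x\<^sup>2}. prime_factors n \<subseteq> A}"
  have "?B \<subseteq> (\<lambda>(B, q). \<Prod>B * q\<^sup>2) ` (Pow A \<times> {1..x})"
  proof
    fix n assume n: "n \<in> ?B"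
    have eq: "n = squarefree_part n * (square_part n)\<^sup>2" by (rule squarefree_decompose)
    have "n > 0" using n by simp
    then have pos: "square_part n > 0" "squarefree_part n > 0"
      using eq by (metis gr0I mult_zero_right zero_power2 not_gr0) (metis gr0I squarefree_part_nonzero)
    have "prime_factors (squarefree_part n) \<subseteq> prime_factors n"
      using \<open>n > 0\<close> eq by (intro dvd_prime_factors) (auto intro: dvdI)
    then have "prime_factors (squarefree_part n) \<in> Pow A" using n by auto
    moreover have "(square_part n)\<^sup>2 \<le> x\<^sup>2"
    proof -
      have "(square_part n)\<^sup>2 \<le> n" using eq pos by (metis dvd_imp_le dvd_triv_right \<open>n > 0\<close>)
      also have "n \<le> x\<^sup>2" using n by simp
      finally show ?thesis .
    qed
    then have "square_part n \<in> {1..x}" using pos by (simp add: power2_nat_le_imp_le Suc_le_eq)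
    ultimately show "n \<in> (\<lambda>(B, q). \<Prod>B * q\<^sup>2) ` (Pow A \<times> {1..x})"
      using eq squarefree_eq_prod_prime_factors[OF squarefree_squarefree_part[of n]]
      by (intro image_eqI[where x = "(prime_factors (squarefree_part n), square_part n)"]) auto
  qed
  then have "card ?B \<le> card (Pow A \<times> {1..x})"
    using assms by (meson surj_card_le finite_Pow_iff finite_SigmaI finite_atLeastAtMost)
  then show ?thesis using assms by (simp add: card_cartesian_product card_Pow)
qed

lemma card_multiples_le:
  assumes "p > 0"
  shows "real (card {n \<in> {1..x}. p dvd n}) \<le> real x / real p"
proof -
  have "{n \<in> {1..x}. p dvd n} \<subseteq> (\<lambda>k. p * k) ` {1..x div p}"
  proof
    fix n assume "n \<in> {n \<in> {1..x}. p dvd n}"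
    then obtain k where k: "n = p * k" "1 \<le> n" "n \<le> x" by auto
    then have "k \<le> x div p" using assms by (simp add: less_eq_div_iff_mult_less_eq mult.commute)
    then show "n \<in> (\<lambda>k. p * k) ` {1..x div p}" using k by (intro image_eqI[of _ _ k]) (auto simp: Suc_le_eq)
  qed
  then have "card {n \<in> {1..x}. p dvd n} \<le> x div p"
    by (metis card_atLeastAtMost diff_Suc_1 finite_atLeastAtMost surj_card_le)
  then show ?thesis using of_nat_div_le_of_nat[of x p, where ?'a = real] by linarith
qed

text \<open>Erdos's argument: if the tail of the series were at most \<open>1/2\<close>, then at least half of the
  numbers up to \<open>x\<^sup>2\<close> would have all their prime factors in a fixed finite set, but there are
  only \<open>O(x)\<close> such numbers.\<close>

lemma not_summable_inverse_primes:
  "\<not> summable (\<lambda>n. 1 / real (enumerate {p::nat. prime p} n))"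
proof
  define q where "q = enumerate {p::nat. prime p}"
  have inf: "infinite {p::nat. prime p}" by (rule primes_infinite)
  have prime_q: "prime (q n)" for n
    using enumerate_in_set[OF inf] by (simp add: q_def)
  then have q_pos: "q n > 0" for n by (simp add: prime_gt_0_nat)
  assume "summable (\<lambda>n. 1 / real (enumerate {p::nat. prime p} n))"
  then have sm: "summable (\<lambda>n. 1 / real (q n))" by (simp add: q_def)
  then obtain N where "norm (\<Sum>i. 1 / real (q (i + N))) < 1 / 2"
    using suminf_exist_split[of "1/2"] by force
  then have tail: "(\<Sum>i. 1 / real (q (i + N))) \<le> 1 / 2" by simp
  have part: "(\<Sum>i\<le>M. 1 / real (q (i + N))) \<le> 1 / 2" for M
  proof -
    have "summable (\<lambda>i. 1 / real (q (i + N)))" using sm by (rule summable_ignore_initial_segment)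
    then have "(\<Sum>i\<le>M. 1 / real (q (i + N))) \<le> (\<Sum>i. 1 / real (q (i + N)))"
      by (intro sum_le_suminf) auto
    with tail show ?thesis by simp
  qed
  define A where "A = q ` {..<N}"
  \<comment> \<open>Chosen to exceed 2^(N+1): the counting below will force \<open>x\<close> to be
    at most that.\<close>
  define x :: nat where "x = 2 ^ (N + 1) + 1"
  let ?S = "{n \<in> {1..x\<^sup>2}. prime_factors n \<subseteq> A}"
  let ?D = "\<lambda>i. {n \<in> {1..x\<^sup>2}. q (i + N) dvd n}"
  have "{1..x\<^sup>2} \<subseteq> ?S \<union> (\<Union>i\<le>x\<^sup>2. ?D i)"
  proof
    fix n assume n: "n \<in> {1..x\<^sup>2}"
    show "n \<in> ?S \<union> (\<Union>i\<le>x\<^sup>2. ?D i)"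
    proof (cases "prime_factors n \<subseteq> A")
      case False
      then obtain p where p: "p \<in> prime_factors n" "p \<notin> A" by auto
      then obtain j where j: "q j = p"
        using enumerate_Ex[OF inf, of p] by (auto simp: q_def)
      with p have "j \<ge> N" by (auto simp: A_def intro: leI)
      \<comment> \<open>The \<open>j\<close>-th prime is at least \<open>j\<close>, so finitely many
        sets \<open>?D i\<close> suffice for the cover.\<close>
      have "j \<le> q j" unfolding q_def by (rule le_enumerate[OF inf])
      also have "q j \<le> x\<^sup>2" using p j n by (auto dest!: dvd_imp_le simp: in_prime_factors_iff)
      ultimately have "j - N \<le> x\<^sup>2" by simp
      then show ?thesis using \<open>j \<ge> N\<close> p j n
        by (auto intro!: bexI[of _ "j - N"] simp: in_prime_factors_iff)
    qed (use n in simp)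
  qed
  then have "card {1..x\<^sup>2} \<le> card (?S \<union> (\<Union>i\<le>x\<^sup>2. ?D i))"
    by (intro card_mono) auto
  also have "\<dots> \<le> card ?S + (\<Sum>i\<le>x\<^sup>2. card (?D i))"
    by (intro order.trans[OF card_Un_le] add_left_mono card_UN_le) auto
  also have "card ?S \<le> 2 ^ N * x"
  proof -
    have "card A \<le> N" unfolding A_def using card_image_le[of "{..<N}" q] by simp
    then show ?thesis
      by (intro order.trans[OF card_smooth_le]) (auto simp: A_def)
  qed
  finally have "real (x\<^sup>2) \<le> real (2 ^ N * x + (\<Sum>i\<le>x\<^sup>2. card (?D i)))"
    by (simp only: card_atLeastAtMost of_nat_le_iff) simp
  also have "\<dots> = 2 ^ N * real x + (\<Sum>i\<le>x\<^sup>2. real (card (?D i)))" by simp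
  also have "(\<Sum>i\<le>x\<^sup>2. real (card (?D i))) \<le> (\<Sum>i\<le>x\<^sup>2. real (x\<^sup>2) / real (q (i + N)))"
    by (intro sum_mono card_multiples_le q_pos)
  also have "\<dots> = real (x\<^sup>2) * (\<Sum>i\<le>x\<^sup>2. 1 / real (q (i + N)))"
    by (simp add: sum_distrib_left)
  also have "\<dots> \<le> real (x\<^sup>2) * (1 / 2)" by (intro mult_left_mono part) simp
  finally have "real x * real x \<le> 2 ^ (N + 1) * real x" by (simp add: power2_eq_square)
  moreover have "x > 0" by (simp add: x_def)
  ultimately have "real x \<le> 2 ^ (N + 1)" by simp
  then show False by (simp add: x_def)
qed

section \<open>Density of finite products\<close>

text \<open>By 1 - t \<le> exp(-t), the product is at most the exponential of minus a partial sum,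
  and these partial sums are unbounded.\<close>

lemma prod_one_minus_less:
  fixes a :: "nat \<Rightarrow> real"
  assumes "\<And>n. 0 \<le> a n" "\<And>n. a n < 1" "\<not> summable a" "x > 0"
  obtains M where "(\<Prod>n = N..<M. 1 - a n) < x"
proof -
  have *: "\<not> summable (\<lambda>n. a (n + N))" using assms(3) by (simp add: summable_iff_shift)
  have "\<exists>M. - ln x < (\<Sum>n<M. a (n + N))"
  proof (rule ccontr)
    assume "\<not> ?thesis"
    then have "summable (\<lambda>n. a (n + N))"
      using assms(1) by (intro bounded_imp_summable[where B = "- ln x"])
        (simp_all add: not_less lessThan_Suc_atMost[symmetric] del: sum.lessThan_Suc)
    with * show False by simp
  qed
  then obtain M where M: "- ln x < (\<Sum>n<M. a (n + N))" by blast
  have "(\<Prod>n = N..<M + N. 1 - a n) = (\<Prod>n<M. 1 - a (n + N))"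
    using prod.shift_bounds_nat_ivl[of "\<lambda>n. 1 - a n" 0 N M] by (simp add: atLeast0LessThan)
  also have "\<dots> \<le> (\<Prod>n<M. exp (- a (n + N)))"
    using assms(2) exp_ge_add_one_self[of "- a (_ + N)"] 
    by (intro prod_mono) (auto simp: less_imp_le)
  also have "\<dots> = exp (- (\<Sum>n<M. a (n + N)))" by (simp add: exp_sum flip: sum_negf)
  also have "\<dots> < exp (ln x)" using M by simp
  finally show ?thesis using that assms(4) by simp
qed

text \<open>Already the products over intervals \<open>{N..<M}\<close> are dense: for large \<open>N\<close> the factors are
  close to 1, so stop when the partial products first drop below the target.\<close>

lemma finite_prods_dense:
  fixes a :: "nat \<Rightarrow> real"
  assumes a: "\<And>n. 0 \<le> a n" "\<And>n. a n < 1" and "\<not> summable a" "a \<longlonglongrightarrow> 0"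
  shows "{0<..1} \<subseteq> closure {\<Prod>n\<in>P. 1 - a n | P. finite P}"
proof
  fix x :: real assume x: "x \<in> {0<..1}"
  show "x \<in> closure {\<Prod>n\<in>P. 1 - a n | P. finite P}"
    unfolding closure_approachable
  proof (intro allI impI)
    fix e :: real assume "e > 0"
    with assms(4) have "\<forall>\<^sub>F n in sequentially. a n < e" by (intro order_tendstoD(2))
    then obtain N where N: "\<And>n. n \<ge> N \<Longrightarrow> a n < e" by (auto simp: eventually_sequentially)
    define Q where "Q M = (\<Prod>n = N..<M. 1 - a n)" for M
    define M where "M = (LEAST M. Q M < x)"
    obtain M' where "Q M' < x"
      using prod_one_minus_less[of a x N] a assms(3) x by (auto simp: Q_def)
    then have M: "Q M < x" unfolding M_def by (rule LeastI)
    \<comment> \<open>The empty product is 1, hence not below \<open>x\<close>; so the first product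
      below \<open>x\<close> has a predecessor \<open>Q K\<close>.\<close>
    have "N < M"
    proof (rule ccontr)
      assume "\<not> N < M"
      then have "Q M = 1" by (simp add: Q_def)
      with M x show False by simp
    qed
    then obtain K where K: "M = Suc K" "N \<le> K" by (cases M) auto
    then have "x \<le> Q K" using not_less_Least[of K "\<lambda>M. Q M < x"] by (simp add: M_def)
    have "Q K \<le> 1" unfolding Q_def using a by (intro prod_le_1) (auto simp: less_imp_le)
    \<comment> \<open>The target lies between \<open>Q M\<close> and \<open>Q K\<close>, whose gap
      is at most \<open>a K\<close>, hence less than \<open>e\<close>.\<close>
    have "Q M = Q K - Q K * a K" using K by (simp add: Q_def algebra_simps)
    moreover have "Q K * a K \<le> 1 * a K" using \<open>Q K \<le> 1\<close> a by (intro mult_right_mono) auto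
    ultimately have "dist (Q M) x < e" using M N[OF K(2)] \<open>x \<le> Q K\<close> by (simp add: dist_real_def)
    then show "\<exists>y\<in>{\<Prod>n\<in>P. 1 - a n | P. finite P}. dist y x < e"
      unfolding Q_def by blast
  qed
qed

section \<open>Density of the products of nilpotency ratios\<close>

theorem theorem2p15:
  fixes m :: nat and S :: "real set"
  assumes "m \<ge> 2"
    and "S = {\<Prod>n\<in>P. nilpotency_ratio (dihedral_group (2 ^ (m - 1) * nth_prime n)) | P.
               P \<subseteq> {1..} \<and> finite P}"
  shows "S \<subseteq> {0<..1} \<and> {0<..1} \<subseteq> closure S"
proof -
  define q where "q = enumerate {p::nat. prime p}"
  \<comment> \<open>A dihedral group of order 2^m p has rotation subgroup of order 2^(m-1) p, whence
    the exponent \<open>m - 1\<close>.\<close>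
  define a where "a n = 1 - nilpotency_ratio (dihedral_group (2 ^ (m - 1) * q n))" for n
  have inf: "infinite {p::nat. prime p}" by (rule primes_infinite)
  have prime_q: "prime (q n)" for n using enumerate_in_set[OF inf] by (simp add: q_def)
  \<comment> \<open>\<open>nth_prime\<close> counts from 1 and \<open>enumerate\<close> from 0;
    below, \<open>Suc\<close> carries index sets over to positive indices.\<close>
  have ratio: "nilpotency_ratio (dihedral_group (2 ^ (m - 1) * nth_prime n)) = 1 - a (n - 1)" for n
    by (simp add: a_def q_def nth_prime_def)
  note bounds = nilpotency_ratio_dihedral_group_prime_bounds[OF prime_q, where M = "m - 1", folded a_def]
  have a_less: "a n < 1" for n
  proof -
    have "1 / (real (q n) + 1) < 1" using prime_gt_0_nat[OF prime_q[of n]] by simp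
    with bounds(2)[of n] show ?thesis by (rule le_less_trans)
  qed
  have "S \<subseteq> {0<..1}"
    unfolding assms(2) ratio using bounds(1) a_less
    by (auto simp: less_imp_le intro!: prod_pos prod_le_1)
  moreover have "{\<Prod>n\<in>P. 1 - a n | P. finite P} \<subseteq> S"
  proof safe
    fix P :: "nat set" assume "finite P"
    then have "(\<Prod>n\<in>P. 1 - a n) = (\<Prod>n\<in>Suc ` P. 1 - a (n - 1))"
      by (simp add: prod.reindex)
    moreover have "Suc ` P \<subseteq> {1..}" "finite (Suc ` P)" using \<open>finite P\<close> by auto
    ultimately show "(\<Prod>n\<in>P. 1 - a n) \<in> S"
      unfolding assms(2) ratio by blast
  qed
  moreover have "a \<longlonglongrightarrow> 0"
  proof (rule tendsto_sandwich)
    show "\<forall>\<^sub>F n in sequentially. 0 \<le> a n" using bounds(1) by simp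
    have "a n \<le> 1 / real (Suc n)" for n
    proof -
      have "n \<le> q n" unfolding q_def by (rule le_enumerate[OF inf])
      then have "1 / (real (q n) + 1) \<le> 1 / real (Suc n)" by (intro divide_left_mono) auto
      with bounds(2)[of n] show ?thesis by simp
    qed
    then show "\<forall>\<^sub>F n in sequentially. a n \<le> 1 / real (Suc n)" by simp
    show "(\<lambda>n. 1 / real (Suc n)) \<longlonglongrightarrow> 0" by (rule lim_1_over_n[THEN LIMSEQ_Suc])
  qed simp
  moreover have "\<not> summable a"
  proof
    assume "summable a"
    then have "summable (\<lambda>n. 2 * a n)" by (rule summable_mult)
    moreover have "norm (1 / real (q n)) \<le> 2 * a n" if "n \<ge> 1" for n
    proof -
      have "q 0 < q n" unfolding q_def using inf that by (intro enumerate_mono) auto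
      then have "q n > 2" using prime_ge_2_nat[OF prime_q[of 0]] by simp
      then have "odd (q n)" using prime_q[of n] by (simp add: prime_odd_nat)
      from bounds(3)[OF this] show ?thesis by (simp add: field_simps)
    qed
    ultimately have "summable (\<lambda>n. 1 / real (q n))" by (rule summable_comparison_test')
    then show False using not_summable_inverse_primes by (simp add: q_def)
  qed
  ultimately have "{0<..1} \<subseteq> closure S"
    using finite_prods_dense[OF bounds(1) a_less] by (meson closure_mono order_trans)
  with \<open>S \<subseteq> {0<..1}\<close> show ?thesis by simp
qed

end
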